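(* Let $d>0$, let $I\subseteq\mathbb{R}$ be bounded, and let $k(x,\nu)$ on $\mathbb{R}\times I$ be such that $\mathcal{K}:L^2(I)\to L^2(\mathbb{R})$, $(\mathcal{K}F)(x)=\langle F,k(x,\cdot)\rangle_{L^2(I)}$, is bounded. Suppose there is a set $\{y_n\}_{n\in\mathbb{Z}}$ in $\mathbb{R}$ such that $\{k(t+y_n,\nu)\}_{n\in\mathbb{Z}}$ forms a frame for $L^2(I)$ for every $t\in[0,d]$, and $d'=\inf_n(y_{n+1}-y_n)\geq d$. Then there exists $c>0$ with $$\Big\|H\Big(\sum_{k\in\mathbb{Z}}\delta_{y_k}\Big)\Big\|_{L^2}\geq c\,\|H\|_{HS},\quad H\in\mathcal{H}^k([0,d]\times I).$$ If the map $\mathcal{K}$ is bounded below, then there are constants $c,C>0$ with $$c\,\|H\|_{HS}\leq\Big\|H\Big(\sum_{k\in\mathbb{Z}}\delta_{y_k}\Big)\Big\|_{L^2}\leq C\,\|H\|_{HS},\quad H\in\mathcal{H}^k([0,d]\times I),$$ and operator reconstruction is possible as $$h_H(t,x)=r(t)\sum_{n\in\mathbb{Z}}\Big(H\sum_{k\in\mathbb{Z}}\delta_{y_k}\Big)(t+y_n)\,\phi_n(t,x),$$ where $\phi_n(t,x)=\int_Ik_n^*(t,\nu)\overline{k(x,\nu)}\,d\nu$ with $\{k_n^*(t,\nu)\}_{n\in\mathbb{Z}}$ being a dual frame of $\{k(t+y_n,\nu)\}_{n\in\mathbb{Z}}$ for each $t$, and $r\equiv1$ on $[0,d]$ with $\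operatorname{supp}r\subseteq[d-d',d']$.
   Context: $HS(L^2(\mathbb{R}))$ is the space of operators $Hf(x)=\int\kappa_H(x,t)f(t)\,dt$ with $\kappa_H\in L^2(\mathbb{R}^2)$, $\|H\|_{HS}=\|\kappa_H\|_{L^2}$. The time-varying impulse response is $h_H(t,x)=\kappa_H(x,x-t)$, so $Hf(x)=\int h_H(t,x)f(x-t)\,dt$ and $\|H\|_{HS}=\|h_H\|_{L^2(\mathbb{R}^2)}$. For $S\subseteq\mathbb{R}\times I$, $\mathcal{H}^k(S)$ is the class of $H\in HS(L^2(\mathbb{R}))$ for which $h_H(t,x)=\langle\zeta_H(t,\cdot),k(x,\cdot)\rangle_{L^2(I)}$ for some $\zeta_H\in L^2(\mathbb{R}\times I)$ with $\operatorname{supp}\zeta_H\subseteq S$. For such $H$, $h_H$ is evaluated pointwise in $x$ through this formula, and the action on a delta train is $(H\sum_{k\in\mathbb{Z}}\delta_{y_k})(x)=\sum_{k\in\mathbb{Z}}h_H(x-y_k,x)$. (The superscript $k$ in $\mathcal{H}^k$ refers to the kernel $k(x,\nu)$, whereas $k$ in $\sum_{k\in\mathbb{Z}}$ is a summation index.) "Bounded below" means there is $a>0$ with $\|\mathcal{K}F\|_{L^2(\mathbb{R})}\geq a\|F\|_{L^2(I)}$ for all $F\in L^2(I)$. A sequence $\{f_n\}$ in a Hilbert space $X$ is a frame if there are $A,B>0$ with $A\|f\|^2\leq\sum_n|\langle f,f_n\rangle|^2\leq B\|f\|^2$ for all $f\in X$; a dual frame $\{\widetilde f_n\}$ is a frame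 with $f=\sum_n\langle f,f_n\rangle\widetilde f_n=\sum_n\langle f,\widetilde f_n\rangle f_n$ for all $f\in X$.
   Formalization: The frames {k(t+y_n,ν)} are assumed to have common frame bounds A, B for all t in [0,d]; with bounds depending on t the norm estimates fail, e.g. k(t+n,ν)=√t·e^{2πinν} for t in (0,1], y_n=n. *)

theory Defs
  imports "HOL-Analysis.Analysis"
begin

text \<open>Elements of \<open>L\<^sup>2\<close> are represented by functions; equality in \<open>L\<^sup>2\<close> is equality almost
  everywhere. A function on \<open>\<real> \<times> I\<close> is a total curried function whose values
  outside \<open>\<real> \<times> I\<close> are never used.\<close>

definition l2 :: "'a measure \<Rightarrow> ('a \<Rightarrow> complex) set" where
  "l2 M = {f \<in> borel_measurable M. integrable M (\<lambda>x. (cmod (f x))\<^sup>2)}"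

definition l2_norm :: "'a measure \<Rightarrow> ('a \<Rightarrow> complex) \<Rightarrow> real" where
  "l2_norm M f = sqrt (LINT x|M. (cmod (f x))\<^sup>2)"

definition l2_inner :: "'a measure \<Rightarrow> ('a \<Rightarrow> complex) \<Rightarrow> ('a \<Rightarrow> complex) \<Rightarrow> complex" where
  "l2_inner M f g = (LINT x|M. f x * cnj (g x))"

text \<open>The support of a class of functions modulo null sets: the complement, in the space of \<open>M\<close>,
  of the largest relatively open set on which the function vanishes almost everywhere.\<close>

definition ess_support :: "'a::topological_space measure \<Rightarrow> ('a \<Rightarrow> complex) \<Rightarrow> 'a set" where
  "ess_support M f =
     {p \<in> space M. \<forall>U. open U \<and> p \<in> U \<longrightarrow> \<not> (AE q in M. q \<in> U \<longrightarrow> f q = 0)}"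

definition frame_bounds :: "'a measure \<Rightarrow> real \<Rightarrow> real \<Rightarrow> (int \<Rightarrow> 'a \<Rightarrow> complex) \<Rightarrow> bool" where
  "frame_bounds M A B f \<longleftrightarrow> 0 < A \<and> 0 < B \<and> (\<forall>n. f n \<in> l2 M) \<and>
     (\<forall>g\<in>l2 M. (\<lambda>n. (cmod (l2_inner M g (f n)))\<^sup>2) summable_on UNIV \<and>
        A * (l2_norm M g)\<^sup>2 \<le> (\<Sum>\<^sub>\<infinity>n. (cmod (l2_inner M g (f n)))\<^sup>2) \<and>
        (\<Sum>\<^sub>\<infinity>n. (cmod (l2_inner M g (f n)))\<^sup>2) \<le> B * (l2_norm M g)\<^sup>2)"

definition is_frame :: "'a measure \<Rightarrow> (int \<Rightarrow> 'a \<Rightarrow> complex) \<Rightarrow> bool" where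
  "is_frame M f \<longleftrightarrow> (\<exists>A B. frame_bounds M A B f)"

text \<open>Unconditional convergence in \<open>L\<^sup>2\<close> norm; for the frame expansions below this is
  equivalent to convergence of symmetric partial sums.\<close>

definition l2_has_sum :: "'a measure \<Rightarrow> (int \<Rightarrow> 'a \<Rightarrow> complex) \<Rightarrow> ('a \<Rightarrow> complex) \<Rightarrow> bool" where
  "l2_has_sum M u g \<longleftrightarrow>
     ((\<lambda>N. l2_norm M (\<lambda>x. g x - (\<Sum>n\<in>N. u n x))) \<longlongrightarrow> 0) (finite_subsets_at_top UNIV)"

definition is_dual_frame ::
  "'a measure \<Rightarrow> (int \<Rightarrow> 'a \<Rightarrow> complex) \<Rightarrow> (int \<Rightarrow> 'a \<Rightarrow> complex) \<Rightarrow> bool" where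
  "is_dual_frame M f f' \<longleftrightarrow> is_frame M f \<and> is_frame M f' \<and>
     (\<forall>g\<in>l2 M. l2_has_sum M (\<lambda>n x. l2_inner M g (f n) * f' n x) g \<and>
                l2_has_sum M (\<lambda>n x. l2_inner M g (f' n) * f n x) g)"

definition kernel_map ::
  "real set \<Rightarrow> (real \<Rightarrow> real \<Rightarrow> complex) \<Rightarrow> (real \<Rightarrow> complex) \<Rightarrow> real \<Rightarrow> complex" where
  "kernel_map I k F x = l2_inner (lebesgue_on I) F (k x)"

definition kernel_map_bounded :: "real set \<Rightarrow> (real \<Rightarrow> real \<Rightarrow> complex) \<Rightarrow> bool" where
  "kernel_map_bounded I k \<longleftrightarrow>
     (\<exists>M. \<forall>F\<in>l2 (lebesgue_on I). kernel_map I k F \<in> l2 lebesgue \<and>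
        l2_norm lebesgue (kernel_map I k F) \<le> M * l2_norm (lebesgue_on I) F)"

definition kernel_map_bounded_below :: "real set \<Rightarrow> (real \<Rightarrow> real \<Rightarrow> complex) \<Rightarrow> bool" where
  "kernel_map_bounded_below I k \<longleftrightarrow>
     (\<exists>a>0. \<forall>F\<in>l2 (lebesgue_on I).
        a * l2_norm (lebesgue_on I) F \<le> l2_norm lebesgue (kernel_map I k F))"

type_synonym operator = "(real \<Rightarrow> complex) \<Rightarrow> real \<Rightarrow> complex"

definition has_hs_kernel :: "operator \<Rightarrow> (real \<Rightarrow> real \<Rightarrow> complex) \<Rightarrow> bool" where
  "has_hs_kernel H \<kappa> \<longleftrightarrow> case_prod \<kappa> \<in> l2 lebesgue \<and>
     (\<forall>f\<in>l2 lebesgue. AE x in lebesgue. H f x = (LINT t|lebesgue. \<kappa> x t * f t))"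

definition hs_operators :: "operator set" where
  "hs_operators = {H. \<exists>\<kappa>. has_hs_kernel H \<kappa>}"

text \<open>The kernel is unique almost everywhere, so the choice below only picks a representative.\<close>

definition hs_kernel :: "operator \<Rightarrow> real \<Rightarrow> real \<Rightarrow> complex" where
  "hs_kernel H = (SOME \<kappa>. has_hs_kernel H \<kappa>)"

definition hs_norm :: "operator \<Rightarrow> real" where
  "hs_norm H = l2_norm lebesgue (case_prod (hs_kernel H))"

definition impulse_response :: "operator \<Rightarrow> real \<Rightarrow> real \<Rightarrow> complex" where
  "impulse_response H t x = hs_kernel H x (x - t)"

text \<open>The value \<open>h\<^sub>H(t,x) = \<langle>\<zeta>(t,\<cdot>), k(x,\<cdot>)\<rangle>\<close>, defined for every \<open>x\<close>
  (and every \<open>t\<close> with \<open>\<zeta>(t,\<cdot>)\<close> in \<open>L\<^sup>2(I)\<close>, hence almost every \<open>t\<close>).\<close>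

definition pointwise_response :: "real set \<Rightarrow> (real \<Rightarrow> real \<Rightarrow> complex) \<Rightarrow>
    (real \<Rightarrow> real \<Rightarrow> complex) \<Rightarrow> real \<Rightarrow> real \<Rightarrow> complex" where
  "pointwise_response I k \<zeta> t x = l2_inner (lebesgue_on I) (\<zeta> t) (k x)"

definition has_symbol :: "real set \<Rightarrow> (real \<Rightarrow> real \<Rightarrow> complex) \<Rightarrow> (real \<times> real) set \<Rightarrow>
    operator \<Rightarrow> (real \<Rightarrow> real \<Rightarrow> complex) \<Rightarrow> bool" where
  "has_symbol I k S H \<zeta> \<longleftrightarrow>
     case_prod \<zeta> \<in> l2 (lebesgue_on (UNIV \<times> I)) \<and>
     ess_support (lebesgue_on (UNIV \<times> I)) (case_prod \<zeta>) \<subseteq> S \<and>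
     (AE (t, x) in lebesgue. impulse_response H t x = pointwise_response I k \<zeta> t x)"

definition op_class :: "real set \<Rightarrow> (real \<Rightarrow> real \<Rightarrow> complex) \<Rightarrow> (real \<times> real) set \<Rightarrow>
    operator set" where
  "op_class I k S = {H \<in> hs_operators. \<exists>\<zeta>. has_symbol I k S H \<zeta>}"

text \<open>The action of the operator with symbol \<open>\<zeta>\<close> on the sum of the Dirac deltas at the points \<open>y\<^sub>n\<close>.\<close>

definition delta_train_response :: "real set \<Rightarrow> (real \<Rightarrow> real \<Rightarrow> complex) \<Rightarrow>
    (real \<Rightarrow> real \<Rightarrow> complex) \<Rightarrow> (int \<Rightarrow> real) \<Rightarrow> real \<Rightarrow> complex" where
  "delta_train_response I k \<zeta> y x = (\<Sum>\<^sub>\<infinity>n. pointwise_response I k \<zeta> (x - y n) x)"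

end

theory Submission
  imports Defs
begin

text \<open>Because \<open>\<zeta>(t,\<cdot>)\<close> vanishes for almost every \<open>t\<close> outside \<open>[0,d]\<close> and consecutive \<open>y\<^sub>n\<close> are at
  least \<open>d' \<ge> d\<close> apart, at almost every \<open>x\<close> at most one term of the delta train response is nonzero.
  Hence its squared modulus is the sum of the squared moduli of its terms, and Tonelli's theorem with
  the substitution \<open>x = t + y\<^sub>n\<close> turns its squared norm into
  \<open>\<integral> \<Sum>\<^sub>n |\<langle>\<zeta>(t,\<cdot>), k(t + y\<^sub>n,\<cdot>)\<rangle>|\<^sup>2 dt\<close>, which the frame inequality compares with \<open>\<parallel>\<zeta>\<parallel>\<^sup>2\<close>. On the other hand
  \<open>\<parallel>H\<parallel>\<^sup>2 = \<integral> \<parallel>K \<zeta>(t,\<cdot>)\<parallel>\<^sup>2 dt\<close>, so the bounds on the kernel map \<open>K\<close> compare \<open>\<parallel>H\<parallel>\<close> with \<open>\<parallel>\<zeta>\<parallel>\<close>.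
  The response at \<open>t + y\<^sub>n\<close> is the \<open>n\<close>-th frame coefficient of \<open>\<zeta>(t,\<cdot>)\<close>, and pairing the dual frame
  expansion of \<open>\<zeta>(t,\<cdot>)\<close> with \<open>k(x,\<cdot>)\<close> gives the reconstruction formula.

  Measurability is only assumed with respect to the completed product measure, whose slices
  carry no information about individual lines such as \<open>x = t + y\<^sub>n\<close>. It is recovered by replacing
  \<open>\<zeta>\<close> and \<open>k\<close> by Borel functions of two variables, each agreeing with it on almost every slice.\<close>

section \<open>Square-integrable functions\<close>

lemma borel_measurable_cnj [measurable (raw)]:
  "f \<in> borel_measurable M \<Longrightarrow> (\<lambda>x. cnj (f x)) \<in> borel_measurable M"
  by (rule borel_measurable_continuous_on[OF continuous_on_cnj[OF continuous_on_id]])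

lemma l2_nn_integral_finite:
  assumes "f \<in> l2 M"
  shows "(\<integral>\<^sup>+x. ennreal ((cmod (f x))\<^sup>2) \<partial>M) < \<infinity>"
  using assms integrableD(2)[of M "\<lambda>x. (cmod (f x))\<^sup>2"] by (simp add: l2_def less_top)

lemma l2I:
  assumes "f \<in> borel_measurable M" "(\<integral>\<^sup>+x. ennreal ((cmod (f x))\<^sup>2) \<partial>M) < \<infinity>"
  shows "f \<in> l2 M"
proof -
  have [measurable]: "f \<in> borel_measurable M" by fact
  show ?thesis
    using assms by (auto simp: l2_def intro!: integrableI_nonneg)
qed

lemma l2_measurable [dest, measurable_dest]: "f \<in> l2 M \<Longrightarrow> f \<in> borel_measurable M"
  by (simp add: l2_def)

lemma l2_norm_nonneg: "0 \<le> l2_norm M f"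
  by (simp add: l2_norm_def)

lemma l2_norm_sq_eq_nn_integral:
  assumes "f \<in> l2 M"
  shows "ennreal ((l2_norm M f)\<^sup>2) = (\<integral>\<^sup>+x. ennreal ((cmod (f x))\<^sup>2) \<partial>M)"
  using assms by (simp add: l2_def l2_norm_def nn_integral_eq_integral)

lemma l2_add:
  assumes "f \<in> l2 M" "g \<in> l2 M"
  shows "(\<lambda>x. f x + g x) \<in> l2 M"
proof (rule l2I)
  have [measurable]: "f \<in> borel_measurable M" "g \<in> borel_measurable M"
    using assms by auto
  show "(\<lambda>x. f x + g x) \<in> borel_measurable M" by measurable
  have "(\<integral>\<^sup>+x. ennreal ((cmod (f x + g x))\<^sup>2) \<partial>M)
      \<le> (\<integral>\<^sup>+x. 2 * ennreal ((cmod (f x))\<^sup>2) + 2 * ennreal ((cmod (g x))\<^sup>2) \<partial>M)"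
  proof (rule nn_integral_mono)
    fix x
    have "(cmod (f x + g x))\<^sup>2 \<le> (cmod (f x) + cmod (g x))\<^sup>2"
      by (intro power_mono norm_triangle_ineq) auto
    also have "\<dots> \<le> 2 * (cmod (f x))\<^sup>2 + 2 * (cmod (g x))\<^sup>2"
      using sum_squares_bound[of "cmod (f x)" "cmod (g x)"] by (simp add: power2_sum)
    finally show "ennreal ((cmod (f x + g x))\<^sup>2) \<le> 2 * ennreal ((cmod (f x))\<^sup>2) + 2 * ennreal ((cmod (g x))\<^sup>2)"
      using ennreal_leI by (fastforce simp: ennreal_mult ennreal_plus)
  qed
  also have "\<dots> = 2 * (\<integral>\<^sup>+x. ennreal ((cmod (f x))\<^sup>2) \<partial>M) + 2 * (\<integral>\<^sup>+x. ennreal ((cmod (g x))\<^sup>2) \<partial>M)"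
    by (simp add: nn_integral_add nn_integral_cmult)
  also have "\<dots> < \<infinity>"
    using assms[THEN l2_nn_integral_finite] by (simp add: ennreal_mult_less_top)
  finally show "(\<integral>\<^sup>+x. ennreal ((cmod (f x + g x))\<^sup>2) \<partial>M) < \<infinity>" .
qed

lemma l2_scale:
  assumes "f \<in> l2 M"
  shows "(\<lambda>x. c * f x) \<in> l2 M"
  using assms by (auto simp: l2_def norm_mult power_mult_distrib)

lemma l2_diff:
  assumes "f \<in> l2 M" "g \<in> l2 M"
  shows "(\<lambda>x. f x - g x) \<in> l2 M"
  using l2_add[OF assms(1) l2_scale[OF assms(2), of "-1"]] by simp

lemma l2_sum:
  assumes "\<And>n. n \<in> N \<Longrightarrow> u n \<in> l2 M"
  shows "(\<lambda>x. \<Sum>n\<in>N. u n x) \<in> l2 M"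
  using assms
proof (induction N rule: infinite_finite_induct)
  case (insert n N)
  then show ?case by (simp add: l2_add)
qed (auto simp: l2_def)

text \<open>Stated for the nonnegative integral so that one estimate serves twice: it proves that
  the product is integrable, and then it bounds the inner product.\<close>

lemma nn_integral_cauchy_schwarz:
  assumes "f \<in> l2 M" "g \<in> l2 M"
  shows "(\<integral>\<^sup>+x. ennreal (norm (f x * cnj (g x))) \<partial>M) \<le> ennreal (l2_norm M f * l2_norm M g)"
proof -
  have [measurable]: "f \<in> borel_measurable M" "g \<in> borel_measurable M"
    using assms by auto
  have "(\<integral>\<^sup>+x. ennreal (norm (f x * cnj (g x))) \<partial>M)\<^sup>2
      = (\<integral>\<^sup>+x. ennreal (cmod (f x)) * ennreal (cmod (g x)) \<partial>M)\<^sup>2"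
    by (simp add: norm_mult ennreal_mult)
  also have "\<dots> \<le> (\<integral>\<^sup>+x. (ennreal (cmod (f x)))\<^sup>2 \<partial>M) * (\<integral>\<^sup>+x. (ennreal (cmod (g x)))\<^sup>2 \<partial>M)"
    by (rule Cauchy_Schwarz_nn_integral) measurable
  also have "\<dots> = ennreal ((l2_norm M f)\<^sup>2) * ennreal ((l2_norm M g)\<^sup>2)"
    using assms by (simp add: l2_norm_sq_eq_nn_integral ennreal_power)
  also have "\<dots> = (ennreal (l2_norm M f * l2_norm M g))\<^sup>2"
    unfolding ennreal_power[OF mult_nonneg_nonneg[OF l2_norm_nonneg l2_norm_nonneg]] power_mult_distrib
    by (rule ennreal_mult[symmetric]) auto
  finally have sq: "(\<integral>\<^sup>+x. ennreal (norm (f x * cnj (g x))) \<partial>M)\<^sup>2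
      \<le> ennreal ((l2_norm M f * l2_norm M g)\<^sup>2)"
    by (simp add: ennreal_power l2_norm_nonneg)
  show ?thesis
  \<comment> \<open>A square root is taken from \<open>sq\<close> in the reals, so the value
    \<open>top\<close> is first excluded by the finite bound on the square.\<close>
  proof (cases "\<integral>\<^sup>+x. ennreal (norm (f x * cnj (g x))) \<partial>M")
    case (real r)
    then have "r\<^sup>2 \<le> (l2_norm M f * l2_norm M g)\<^sup>2"
      using sq by (simp add: ennreal_power)
    then show ?thesis
      using real power2_le_imp_le by (auto simp: l2_norm_nonneg)
  next
    case top
    then show ?thesis
      using sq by (simp add: top_unique)
  qed
qed

lemma integrable_l2_inner:
  assumes "f \<in> l2 M" "g \<in> l2 M"
  shows "integrable M (\<lambda>x. f x * cnj (g x))"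
proof -
  have [measurable]: "f \<in> borel_measurable M" "g \<in> borel_measurable M"
    using assms by auto
  show ?thesis
    using nn_integral_cauchy_schwarz[OF assms]
    by (auto simp: integrable_iff_bounded intro: le_less_trans)
qed

lemma norm_l2_inner_le:
  assumes "f \<in> l2 M" "g \<in> l2 M"
  shows "cmod (l2_inner M f g) \<le> l2_norm M f * l2_norm M g"
proof -
  have "ennreal (cmod (l2_inner M f g)) \<le> (\<integral>\<^sup>+x. ennreal (norm (f x * cnj (g x))) \<partial>M)"
    unfolding l2_inner_def by (rule integral_norm_bound_ennreal[OF integrable_l2_inner[OF assms]])
  also note nn_integral_cauchy_schwarz[OF assms]
  finally show ?thesis
    by (simp add: l2_norm_nonneg)
qed

text \<open>By Cauchy-Schwarz, pairing with \<open>v\<close> is continuous in norm, so the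
  remainders of the partial sums pair to something that tends to 0.\<close>

lemma l2_has_sum_imp_has_sum_inner:
  assumes "l2_has_sum M u g" "g \<in> l2 M" "\<And>n. u n \<in> l2 M" "v \<in> l2 M"
  shows "((\<lambda>n. l2_inner M (u n) v) has_sum l2_inner M g v) UNIV"
  unfolding has_sum_def
proof (subst Lim_null, subst tendsto_norm_zero_iff[symmetric], rule tendsto_sandwich[of "\<lambda>_. 0"])
  have *: "(\<Sum>n\<in>N. l2_inner M (u n) v) - l2_inner M g v = - l2_inner M (\<lambda>x. g x - (\<Sum>n\<in>N. u n x)) v" for N
    using assms by (simp add: l2_inner_def left_diff_distrib sum_distrib_right integrable_l2_inner)
  show "\<forall>\<^sub>F N in finite_subsets_at_top UNIV.
      norm ((\<Sum>n\<in>N. l2_inner M (u n) v) - l2_inner M g v)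
        \<le> l2_norm M (\<lambda>x. g x - (\<Sum>n\<in>N. u n x)) * l2_norm M v"
    unfolding * norm_minus_cancel
    by (intro always_eventually allI norm_l2_inner_le l2_diff l2_sum assms)
  show "((\<lambda>N. l2_norm M (\<lambda>x. g x - (\<Sum>n\<in>N. u n x)) * l2_norm M v) \<longlongrightarrow> 0) (finite_subsets_at_top UNIV)"
    using assms(1) tendsto_mult_left_zero unfolding l2_has_sum_def by blast
qed (auto intro!: always_eventually)

lemma is_dual_frame_has_sum_inner:
  assumes "is_dual_frame M f f'" "g \<in> l2 M" "v \<in> l2 M"
  shows "((\<lambda>n. l2_inner M g (f n) * l2_inner M (f' n) v) has_sum l2_inner M g v) UNIV"
proof -
  have "\<And>n. f' n \<in> l2 M"
    using assms(1) by (auto simp: is_dual_frame_def is_frame_def frame_bounds_def)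
  then have "((\<lambda>n. l2_inner M (\<lambda>x. l2_inner M g (f n) * f' n x) v) has_sum l2_inner M g v) UNIV"
    using assms by (intro l2_has_sum_imp_has_sum_inner l2_scale) (auto simp: is_dual_frame_def)
  then show ?thesis
    by (simp add: l2_inner_def mult.assoc)
qed

section \<open>Sums as integrals with respect to the counting measure\<close>

text \<open>Frame inequalities are about \<open>infsum\<close>, whereas Tonelli needs an integral
  over the index set; nonnegativity makes the summability absolute and lets the two be
  identified.\<close>

lemma ennreal_infsum_eq_nn_integral:
  fixes f :: "'a \<Rightarrow> real"
  assumes "f summable_on UNIV" "\<And>n. 0 \<le> f n"
  shows "ennreal (\<Sum>\<^sub>\<infinity>n. f n) = (\<integral>\<^sup>+n. ennreal (f n) \<partial>count_space UNIV)"
proof -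
  have "Infinite_Sum.abs_summable_on f UNIV"
    using assms by simp
  then have *: "Infinite_Set_Sum.abs_summable_on f UNIV"
    by (simp add: abs_summable_equivalent del: real_norm_def)
  then have "(\<Sum>\<^sub>\<infinity>n. f n) = (LINT n|count_space UNIV. f n)"
    by (simp add: infsetsum_infsum[symmetric] infsetsum_def)
  then show ?thesis
    using * assms(2) by (simp add: nn_integral_eq_integral Infinite_Set_Sum.abs_summable_on_def set_integrable_def)
qed

lemma has_sum_single:
  fixes f :: "'a \<Rightarrow> 'b::{comm_monoid_add, topological_space}"
  assumes "\<And>n. n \<noteq> m \<Longrightarrow> f n = 0"
  shows "(f has_sum f m) UNIV"
  by (rule has_sum_finite_neutralI[of "{m}"]) (use assms in auto)

text \<open>With a single nonzero term, the square of the sum has no cross terms.\<close>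

lemma norm_sq_infsum_single:
  fixes f :: "'a \<Rightarrow> complex"
  assumes "\<And>n. n \<noteq> m \<Longrightarrow> f n = 0"
  shows "ennreal ((cmod (\<Sum>\<^sub>\<infinity>n. f n))\<^sup>2) = (\<integral>\<^sup>+n. ennreal ((cmod (f n))\<^sup>2) \<partial>count_space UNIV)"
proof -
  have "((\<lambda>n. (cmod (f n))\<^sup>2) has_sum (cmod (f m))\<^sup>2) UNIV"
    using assms by (intro has_sum_single) auto
  then have "(\<lambda>n. (cmod (f n))\<^sup>2) summable_on UNIV" "(\<Sum>\<^sub>\<infinity>n. (cmod (f n))\<^sup>2) = (cmod (f m))\<^sup>2"
    by (auto simp: summable_on_def infsumI)
  then show ?thesis
    using infsumI[OF has_sum_single[of m f]] assms ennreal_infsum_eq_nn_integral[of "\<lambda>n. (cmod (f n))\<^sup>2"]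
    by simp
qed

section \<open>Lebesgue measurable functions and their Borel representatives\<close>

lemma completion_ex_borel_measurable_complex:
  fixes f :: "'a \<Rightarrow> complex"
  assumes [measurable]: "f \<in> borel_measurable (completion M)"
  shows "\<exists>g\<in>borel_measurable M. AE x in M. f x = g x"
proof -
  obtain a where a: "a \<in> borel_measurable M" "AE x in M. Re (f x) = a x"
    using completion_ex_borel_measurable_real[of "\<lambda>x. Re (f x)" M] by auto
  obtain b where b: "b \<in> borel_measurable M" "AE x in M. Im (f x) = b x"
    using completion_ex_borel_measurable_real[of "\<lambda>x. Im (f x)" M] by auto
  have [measurable]: "a \<in> borel_measurable M" "b \<in> borel_measurable M" by fact+
  show ?thesis
  proof (rule bexI[of _ "\<lambda>x. Complex (a x) (b x)"])
    show "AE x in M. f x = Complex (a x) (b x)"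
      using a(2) b(2) by eventually_elim (simp add: complex_eq_iff)
    show "(\<lambda>x. Complex (a x) (b x)) \<in> borel_measurable M"
      by (simp add: Complex_eq)
  qed
qed

text \<open>Preimages under \<open>f\<close> and \<open>g\<close> differ only inside a null set, and
  all subsets of null sets are measurable in the completion.\<close>

lemma completion_measurable_AE_eq:
  assumes g: "g \<in> measurable M N" and ae: "AE x in M. f x = g x"
    and f: "\<And>x. x \<in> space M \<Longrightarrow> f x \<in> space N"
  shows "f \<in> measurable (completion M) N"
proof (rule measurableI)
  fix A assume A: "A \<in> sets N"
  have "AE x in completion M. x \<in> g -` A \<inter> space M \<longleftrightarrow> x \<in> f -` A \<inter> space M"
    unfolding AE_completion_iff using ae by eventually_elim auto
  moreover have "g -` A \<inter> space M \<in> sets (completion M)"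
    using measurable_sets[OF g A] by (rule sets_completionI_sets)
  moreover have "f -` A \<inter> space M \<subseteq> space (completion M)"
    by simp
  ultimately have "f -` A \<inter> space M \<in> sets (completion M)"
    by (rule completion.in_sets_AE)
  then show "f -` A \<inter> space (completion M) \<in> sets (completion M)"
    by (simp only: space_completion)
qed (use f in auto)

lemma AE_lborel_pairD:
  assumes "AE q in lborel. P (fst q) (snd q)"
  shows "AE t in lborel. AE x in lborel. P (t :: 'a::euclidean_space) (x :: 'b::euclidean_space)"
proof -
  have "AE q in lborel \<Otimes>\<^sub>M lborel. P (fst q) (snd q)"
    using assms by (simp only: lborel_prod)
  from lborel_pair.AE_pair[OF this] show ?thesis by simp
qed

lemma AE_lborel_translate:
  fixes c :: "'a::euclidean_space"
  assumes "AE x in lborel. P x"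
  shows "AE x in lborel. P (x + c)"
proof -
  have "AE x in lborel. P (c + x)"
    using assms by (intro AE_distrD[of "(+) c" lborel borel]) (simp, simp only: lborel_distr_plus)
  then show ?thesis
    by (simp add: add.commute)
qed

text \<open>A Lebesgue set is a Borel set plus part of a Borel null set \<open>N'\<close>, and the
  strip over \<open>N'\<close> is null in the product because its measure is a product with factor
  0.\<close>

lemma UNIV_Times_in_sets_lebesgue:
  fixes I :: "'b::euclidean_space set"
  assumes "I \<in> sets lebesgue"
  shows "(UNIV :: 'a::euclidean_space set) \<times> I \<in> sets lebesgue"
proof -
  obtain S N N' where I: "I = S \<union> N" "N \<subseteq> N'" "N' \<in> null_sets lborel" "S \<in> sets borel"
    using assms by (auto elim: sets_completionE)
  show ?thesis
  proof (rule sets_completionI)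
    show "UNIV \<times> I = UNIV \<times> S \<union> UNIV \<times> N" "UNIV \<times> N \<subseteq> UNIV \<times> N'"
      using I by auto
    show "(UNIV :: 'a set) \<times> S \<in> sets lborel"
      using I by (simp add: borel_prod[symmetric])
    have "emeasure (lborel \<Otimes>\<^sub>M lborel) ((UNIV :: 'a set) \<times> N') = 0"
      using I by (subst lborel.emeasure_pair_measure_Times) (auto simp: null_sets_def)
    then show "(UNIV :: 'a set) \<times> N' \<in> null_sets lborel"
      using I by (simp add: lborel_prod null_sets_def borel_prod[symmetric])
  qed
qed

text \<open>This change of variables turns the kernel \<kappa>(x,s) into the impulse response
  \<kappa>(x,x-t). By Tonelli it is enough to fix \<open>x\<close>, where the map is the reflection
  of \<open>t\<close> about x/2.\<close>

lemma lborel_shear: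
  "distr lborel borel (\<lambda>(t, x). (x, x - t)) = (lborel :: (real \<times> real) measure)"
proof (rule measure_eqI)
  show "sets (distr lborel borel (\<lambda>(t, x). (x, x - t))) = sets (lborel :: (real \<times> real) measure)"
    by simp
  fix A assume "A \<in> sets (distr lborel borel (\<lambda>(t, x). (x, x - t :: real)))"
  then have A: "A \<in> sets borel" and [measurable]: "A \<in> sets (borel \<Otimes>\<^sub>M borel)"
    by (simp_all only: sets_distr borel_prod)
  have T: "(\<lambda>(t, x). (x, x - t :: real)) \<in> measurable lborel borel"
    by (auto simp: case_prod_beta' intro!: borel_measurable_continuous_onI continuous_intros)
  have "emeasure (distr lborel borel (\<lambda>(t, x). (x, x - t))) A
      = (\<integral>\<^sup>+q. indicator A (case q of (t, x) \<Rightarrow> (x, x - t)) \<partial>lborel)"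
    using A by (subst nn_integral_indicator[symmetric], simp, subst nn_integral_distr[OF T]) simp_all
  also have "\<dots> = (\<integral>\<^sup>+t. \<integral>\<^sup>+x. indicator A (x, x - t) \<partial>lborel \<partial>lborel)"
    by (subst lborel_prod[symmetric], subst lborel.nn_integral_fst[symmetric]) simp_all
  also have "\<dots> = (\<integral>\<^sup>+x. \<integral>\<^sup>+t. indicator A (x, x - t) \<partial>lborel \<partial>lborel)"
    by (rule lborel_pair.Fubini'[symmetric]) simp
  also have "\<dots> = (\<integral>\<^sup>+x. \<integral>\<^sup>+t. indicator A (x, t) \<partial>lborel \<partial>lborel)"
  proof (rule nn_integral_cong)
    fix x :: real
    show "(\<integral>\<^sup>+t. indicator A (x, x - t) \<partial>lborel) = (\<integral>\<^sup>+t. indicator A (x, t) \<partial>lborel)"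
      by (subst (2) nn_integral_real_affine[of _ "-1" x]) auto
  qed
  also have "\<dots> = emeasure lborel A"
    by (subst lborel.nn_integral_fst, simp, subst lborel_prod) (simp add: borel_prod[symmetric])
  finally show "emeasure (distr lborel borel (\<lambda>(t, x). (x, x - t))) A = emeasure lborel A" .
qed

text \<open>Extending by zero off \<open>I\<close> moves the problem to the whole plane, where a
  Lebesgue measurable function has a Borel version. All slices of the Borel version are Borel, and
  its integrals depend measurably on parameters.\<close>

lemma borel_slices:
  fixes f :: "real \<Rightarrow> real \<Rightarrow> complex"
  assumes "case_prod f \<in> borel_measurable (lebesgue_on (UNIV \<times> I))" "I \<in> sets lebesgue"
  obtains F where "case_prod F \<in> borel_measurable (borel \<Otimes>\<^sub>M borel)"
    "AE q in lborel. F (fst q) (snd q) = (if snd q \<in> I then f (fst q) (snd q) else 0)"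
proof -
  have "(\<lambda>q. if q \<in> UNIV \<times> I then case_prod f q else 0) \<in> borel_measurable lebesgue"
    using assms UNIV_Times_in_sets_lebesgue by (intro borel_measurable_if_I)
  from completion_ex_borel_measurable_complex[OF this]
  obtain F where F: "F \<in> borel_measurable lborel"
     "AE q in lborel. (if q \<in> UNIV \<times> I then case_prod f q else 0) = F q" by blast
  show ?thesis
  proof (rule that[of "curry F"])
    show "case_prod (curry F) \<in> borel_measurable (borel \<Otimes>\<^sub>M borel)"
      using F(1) by (simp add: borel_prod)
    show "AE q in lborel. curry F (fst q) (snd q) = (if snd q \<in> I then f (fst q) (snd q) else 0)"
      using F(2) by eventually_elim (auto simp: mem_Times_iff split: if_splits)
  qed
qed

context
  fixes I :: "real set" and f F :: "real \<Rightarrow> complex"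
  assumes I: "I \<in> sets lebesgue" and F: "F \<in> borel_measurable borel"
    and ae: "AE x in lborel. F x = (if x \<in> I then f x else 0)"
begin

lemma slice_measurable: "f \<in> borel_measurable (lebesgue_on I)"
proof -
  have "(\<lambda>x. if x \<in> I then f x else 0) \<in> borel_measurable lebesgue"
    using F ae by (intro completion_measurable_AE_eq[of F]) (auto elim: eventually_mono)
  then show ?thesis
    using borel_measurable_if_D by blast
qed

lemma slice_nn_integral:
  "(\<integral>\<^sup>+x. ennreal ((cmod (f x))\<^sup>2) \<partial>lebesgue_on I) = (\<integral>\<^sup>+x. ennreal ((cmod (F x))\<^sup>2) \<partial>lborel)"
proof -
  have "(\<integral>\<^sup>+x. ennreal ((cmod (f x))\<^sup>2) \<partial>lebesgue_on I)
     = (\<integral>\<^sup>+x. ennreal ((cmod (f x))\<^sup>2) * indicator I x \<partial>lborel)"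
    using I by (subst nn_integral_restrict_space) (auto simp: nn_integral_completion)
  also have "\<dots> = (\<integral>\<^sup>+x. ennreal ((cmod (F x))\<^sup>2) \<partial>lborel)"
    using ae by (intro nn_integral_cong_AE, eventually_elim) (auto simp: indicator_def)
  finally show ?thesis .
qed

end

text \<open>Used to write an inner product of two slices as an integral of jointly Borel functions,
  whose measurability in the slice parameters is then automatic.\<close>

lemma slice_inner:
  fixes f g F G :: "real \<Rightarrow> complex"
  assumes I: "I \<in> sets lebesgue"
    and F: "F \<in> borel_measurable borel" "AE x in lborel. F x = (if x \<in> I then f x else 0)"
    and G: "G \<in> borel_measurable borel" "AE x in lborel. G x = (if x \<in> I then g x else 0)"
  shows "l2_inner (lebesgue_on I) f g = (LINT x|lborel. F x * cnj (G x))"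
proof -
  have [measurable]: "F \<in> borel_measurable borel" "G \<in> borel_measurable borel" by fact+
  have ae: "AE x in lborel. indicator I x *\<^sub>R (f x * cnj (g x)) = F x * cnj (G x)"
    using F(2) G(2) by eventually_elim (auto simp: indicator_def)
  then have "(\<lambda>x. indicator I x *\<^sub>R (f x * cnj (g x))) \<in> borel_measurable lebesgue"
    by (rule completion_measurable_AE_eq[rotated]) (simp_all, measurable)
  then have "(LINT x|lebesgue. indicator I x *\<^sub>R (f x * cnj (g x))) = (LINT x|lebesgue. F x * cnj (G x))"
    using ae by (intro integral_cong_AE) (auto simp: AE_completion_iff intro: measurable_completion)
  then show ?thesis
    using I by (simp add: l2_inner_def integral_restrict_space integral_completion)
qed

text \<open>The complement of the support is a union of possibly uncountably many open sets on which
  \<open>f\<close> vanishes almost everywhere; by Lindelof countably many of them cover it, so the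
  exceptional null sets can be united.\<close>

lemma AE_zero_outside_ess_support:
  fixes M :: "'a::second_countable_topology measure"
  shows "AE p in M. p \<notin> ess_support M f \<longrightarrow> f p = 0"
proof -
  define \<U> where "\<U> = {U. open U \<and> (AE q in M. q \<in> U \<longrightarrow> f q = 0)}"
  obtain \<V> where \<V>: "\<V> \<subseteq> \<U>" "countable \<V>" "\<Union>\<V> = \<Union>\<U>"
    by (rule Lindelof[of \<U>]) (auto simp: \<U>_def)
  have "AE q in M. \<forall>U\<in>\<V>. q \<in> U \<longrightarrow> f q = 0"
    using \<V> by (subst AE_ball_countable) (auto simp: \<U>_def)
  then show ?thesis
    using AE_space
  proof eventually_elim
    case (elim p)
    show ?case
    proof
      assume "p \<notin> ess_support M f"
      then have "p \<in> \<Union>\<U>"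
        using elim(2) by (auto simp: ess_support_def \<U>_def)
      then show "f p = 0"
        using elim(1) unfolding \<V>(3)[symmetric] by blast
    qed
  qed
qed

lemma hs_norm_sq_eq_nn_integral_response:
  assumes "H \<in> hs_operators" "has_symbol I k S H \<zeta>"
  shows "ennreal ((hs_norm H)\<^sup>2) =
    (\<integral>\<^sup>+t. \<integral>\<^sup>+x. ennreal ((cmod (pointwise_response I k \<zeta> t x))\<^sup>2) \<partial>lborel \<partial>lborel)"
proof -
  let ?\<kappa> = "hs_kernel H"
  have "has_hs_kernel H ?\<kappa>"
    using assms(1) unfolding hs_operators_def hs_kernel_def by (metis (mono_tags, lifting) mem_Collect_eq someI)
  then have \<kappa>: "case_prod ?\<kappa> \<in> l2 lebesgue"
    by (simp add: has_hs_kernel_def)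
  obtain G where G: "G \<in> borel_measurable lborel" "AE q in lborel. case_prod ?\<kappa> q = G q"
    using completion_ex_borel_measurable_complex[OF l2_measurable[OF \<kappa>]] by blast
  \<comment> \<open>The Borel version \<open>G\<close> of the kernel can be composed with the shear
    and integrated iteratively; the kernel itself is only Lebesgue measurable.\<close>
  have [measurable]: "G \<in> borel_measurable (borel \<Otimes>\<^sub>M borel)"
    using G(1) by (simp add: borel_prod)
  let ?T = "\<lambda>(t, x). (x, x - t :: real)"
  have T: "?T \<in> measurable lborel borel"
    by (auto simp: case_prod_beta' intro!: borel_measurable_continuous_onI continuous_intros)
  have "AE q in lborel. G (?T q) = case_prod ?\<kappa> (?T q)"
  proof (rule AE_distrD[OF T])
    show "AE q in distr lborel borel ?T. G q = case_prod ?\<kappa> q"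
      unfolding lborel_shear using G(2) by eventually_elim simp
  qed
  moreover have "AE q in lborel. case_prod ?\<kappa> (?T q) = pointwise_response I k \<zeta> (fst q) (snd q)"
    using assms(2) by (auto simp: has_symbol_def AE_completion_iff impulse_response_def case_prod_beta')
  ultimately have "AE q in lborel. G (snd q, snd q - fst q) = pointwise_response I k \<zeta> (fst q) (snd q)"
    by eventually_elim (auto simp: case_prod_beta')
  then have eq: "AE t in lborel. AE x in lborel. G (x, x - t) = pointwise_response I k \<zeta> t x"
    by (rule AE_lborel_pairD)
  have "ennreal ((hs_norm H)\<^sup>2) = (\<integral>\<^sup>+q. ennreal ((cmod (case_prod ?\<kappa> q))\<^sup>2) \<partial>lborel)"
    unfolding hs_norm_def l2_norm_sq_eq_nn_integral[OF \<kappa>] nn_integral_completion ..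
  also have "\<dots> = (\<integral>\<^sup>+q. ennreal ((cmod (G q))\<^sup>2) \<partial>lborel)"
    using G(2) by (intro nn_integral_cong_AE) (auto elim: eventually_mono)
  also have "\<dots> = (\<integral>\<^sup>+q. ennreal ((cmod (G (?T q)))\<^sup>2) \<partial>lborel)"
    using G(1) by (subst lborel_shear[symmetric], subst nn_integral_distr[OF T]) simp_all
  also have "\<dots> = (\<integral>\<^sup>+t. \<integral>\<^sup>+x. ennreal ((cmod (G (x, x - t)))\<^sup>2) \<partial>lborel \<partial>lborel)"
    by (subst lborel_prod[symmetric], subst lborel.nn_integral_fst[symmetric]) simp_all
  also have "\<dots> = (\<integral>\<^sup>+t. \<integral>\<^sup>+x. ennreal ((cmod (pointwise_response I k \<zeta> t x))\<^sup>2) \<partial>lborel \<partial>lborel)"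
  proof (rule nn_integral_cong_AE)
    show "AE t in lborel. (\<integral>\<^sup>+x. ennreal ((cmod (G (x, x - t)))\<^sup>2) \<partial>lborel)
        = (\<integral>\<^sup>+x. ennreal ((cmod (pointwise_response I k \<zeta> t x))\<^sup>2) \<partial>lborel)"
      using eq
    proof eventually_elim
      case (elim t)
      then show ?case
        by (intro nn_integral_cong_AE) (auto elim: eventually_mono)
    qed
  qed
  finally show ?thesis .
qed

section \<open>Energy of the delta train response\<close>

text \<open>The frame bounds \<open>A\<close> and \<open>B\<close> are common to all
  \<open>t\<close> in \<open>{0..d}\<close>; this uniformity lets the slicewise inequalities be
  integrated over \<open>t\<close> with one constant.\<close>

locale delta_sampling =
  fixes d d' A B :: real
    and I :: "real set"
    and k :: "real \<Rightarrow> real \<Rightarrow> complex"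
    and y :: "int \<Rightarrow> real"
  assumes I_meas: "I \<in> sets lebesgue"
    and k_meas: "case_prod k \<in> borel_measurable (lebesgue_on (UNIV \<times> I))"
    and k_l2: "\<And>x. k x \<in> l2 (lebesgue_on I)"
    and K_bounded: "kernel_map_bounded I k"
    and frame: "\<And>t. t \<in> {0..d} \<Longrightarrow> frame_bounds (lebesgue_on I) A B (\<lambda>n. k (t + y n))"
    and d_pos: "0 < d"
    and d_le_d': "d \<le> d'"
    and y_step: "\<And>n. d' \<le> y (n + 1) - y n"
begin

text \<open>Consecutive gaps add up, and each further one is positive because 0 < d and d \<le>
  d'.\<close>

lemma gap:
  assumes "m < n"
  shows "d' \<le> y n - y m"
  using assms
proof (induction n rule: int_gr_induct)
  case (step n)
  then show ?case
    using step.IH y_step[of n] d_pos d_le_d' by linarith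
qed (use y_step in simp)

lemma frame_bound_pos: "0 < A" "0 < B"
  using frame[of 0] d_pos by (auto simp: frame_bounds_def)

lemma frame_sum_bounds:
  assumes "t \<in> {0..d}" "g \<in> l2 (lebesgue_on I)"
  shows "ennreal A * ennreal ((l2_norm (lebesgue_on I) g)\<^sup>2)
      \<le> (\<integral>\<^sup>+n. ennreal ((cmod (l2_inner (lebesgue_on I) g (k (t + y n))))\<^sup>2) \<partial>count_space UNIV)"
    and "(\<integral>\<^sup>+n. ennreal ((cmod (l2_inner (lebesgue_on I) g (k (t + y n))))\<^sup>2) \<partial>count_space UNIV)
      \<le> ennreal B * ennreal ((l2_norm (lebesgue_on I) g)\<^sup>2)"
proof -
  let ?f = "\<lambda>n. (cmod (l2_inner (lebesgue_on I) g (k (t + y n))))\<^sup>2"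
  have *: "?f summable_on UNIV" "A * (l2_norm (lebesgue_on I) g)\<^sup>2 \<le> infsum ?f UNIV"
    "infsum ?f UNIV \<le> B * (l2_norm (lebesgue_on I) g)\<^sup>2"
    using frame[OF assms(1)] assms(2) by (auto simp: frame_bounds_def)
  show "ennreal A * ennreal ((l2_norm (lebesgue_on I) g)\<^sup>2) \<le> (\<integral>\<^sup>+n. ennreal (?f n) \<partial>count_space UNIV)"
    "(\<integral>\<^sup>+n. ennreal (?f n) \<partial>count_space UNIV) \<le> ennreal B * ennreal ((l2_norm (lebesgue_on I) g)\<^sup>2)"
    using ennreal_leI[OF *(2)] ennreal_leI[OF *(3)] frame_bound_pos
    by (simp_all add: ennreal_infsum_eq_nn_integral[OF *(1)] ennreal_mult)
qed

section \<open>Slices of a fixed symbol supported in [0,d] x I\<close>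

context
  fixes \<zeta> :: "real \<Rightarrow> real \<Rightarrow> complex"
  assumes symbol_l2: "case_prod \<zeta> \<in> l2 (lebesgue_on (UNIV \<times> I))"
    and supp: "ess_support (lebesgue_on (UNIV \<times> I)) (case_prod \<zeta>) \<subseteq> {0..d} \<times> I"
begin

abbreviation resp :: "real \<Rightarrow> real \<Rightarrow> complex" where
  "resp \<equiv> pointwise_response I k \<zeta>"

abbreviation train :: "real \<Rightarrow> complex" where
  "train \<equiv> delta_train_response I k \<zeta> y"

definition slice_energy :: "real \<Rightarrow> ennreal" where
  "slice_energy t = ennreal ((l2_norm (lebesgue_on I) (\<zeta> t))\<^sup>2)"

text \<open>Tonelli for a Borel version of \<zeta> gives a Borel function \<open>z\<close> that
  equals \<open>slice_energy\<close> almost everywhere. The scaling rule is derived through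
  \<open>z\<close> because \<open>slice_energy\<close> itself has not been shown measurable.\<close>

lemma slices_l2: "AE t in lborel. \<zeta> t \<in> l2 (lebesgue_on I)" (is ?l2)
  and slice_energy_cmult:
    "(\<integral>\<^sup>+t. c * slice_energy t \<partial>lborel) = c * (\<integral>\<^sup>+t. slice_energy t \<partial>lborel)" (is ?cmult)
  and slice_energy_finite: "(\<integral>\<^sup>+t. slice_energy t \<partial>lborel) < \<infinity>" (is ?fin)
proof -
  obtain F where F[measurable]: "case_prod F \<in> borel_measurable (borel \<Otimes>\<^sub>M borel)"
    and F_eq: "AE q in lborel. F (fst q) (snd q) = (if snd q \<in> I then \<zeta> (fst q) (snd q) else 0)"
    using borel_slices[OF l2_measurable[OF symbol_l2] I_meas] .
  define z where "z t = (\<integral>\<^sup>+\<nu>. ennreal ((cmod (F t \<nu>))\<^sup>2) \<partial>lborel)" for t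
  have [measurable]: "z \<in> borel_measurable borel"
    unfolding z_def by measurable
  have "(\<integral>\<^sup>+t. z t \<partial>lborel) = (\<integral>\<^sup>+q. ennreal ((cmod (case_prod F q))\<^sup>2) \<partial>lborel)"
    unfolding z_def by (subst lborel_prod[symmetric], subst lborel.nn_integral_fst[symmetric]) simp_all
  also have "\<dots> = (\<integral>\<^sup>+q. ennreal ((cmod (case_prod \<zeta> q))\<^sup>2) * indicator (UNIV \<times> I) q \<partial>lborel)"
    using F_eq by (intro nn_integral_cong_AE, eventually_elim) (auto simp: indicator_def split: if_splits)
  also have "\<dots> = (\<integral>\<^sup>+q. ennreal ((cmod (case_prod \<zeta> q))\<^sup>2) \<partial>lebesgue_on (UNIV \<times> I))"
    using UNIV_Times_in_sets_lebesgue[OF I_meas]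
    by (subst nn_integral_restrict_space) (auto simp: nn_integral_completion)
  also have "\<dots> < \<infinity>"
    by (rule l2_nn_integral_finite[OF symbol_l2])
  finally have z_fin: "(\<integral>\<^sup>+t. z t \<partial>lborel) < \<infinity>" .
  then have "AE t in lborel. z t \<noteq> \<infinity>"
    by (intro nn_integral_PInf_AE) auto
  moreover have "AE t in lborel. AE \<nu> in lborel. F t \<nu> = (if \<nu> \<in> I then \<zeta> t \<nu> else 0)"
    using F_eq by (rule AE_lborel_pairD)
  ultimately have z: "AE t in lborel. \<zeta> t \<in> l2 (lebesgue_on I) \<and> slice_energy t = z t"
  proof eventually_elim
    case (elim t)
    have F_t: "F t \<in> borel_measurable borel"
      by measurable
    have "(\<integral>\<^sup>+\<nu>. ennreal ((cmod (\<zeta> t \<nu>))\<^sup>2) \<partial>lebesgue_on I) = z t"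
      unfolding z_def by (rule slice_nn_integral[OF I_meas F_t elim(2)])
    moreover have "\<zeta> t \<in> l2 (lebesgue_on I)"
      using elim(1) slice_measurable[OF I_meas F_t elim(2)] calculation by (auto simp: less_top intro!: l2I)
    ultimately show ?case
      by (simp add: slice_energy_def l2_norm_sq_eq_nn_integral)
  qed
  then show ?l2
    by eventually_elim simp
  have "(\<integral>\<^sup>+t. c * slice_energy t \<partial>lborel) = (\<integral>\<^sup>+t. c * z t \<partial>lborel)" for c
    using z by (intro nn_integral_cong_AE) (auto elim: eventually_mono)
  \<comment> \<open>The instance 1 identifies the integral of \<open>slice_energy\<close> with that
    of \<open>z\<close>, which is finite.\<close>
  from this[of c] this[of 1] show ?cmult ?fin
    using z_fin by (simp_all add: nn_integral_cmult)
qed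

text \<open>Fubini makes almost every slice outside \<open>{0..d}\<close> vanish almost everywhere.
  The exceptional set of \<open>t\<close> does not depend on \<open>x\<close>, since
  \<open>k x\<close> enters only as a factor of the integrand.\<close>

lemma slices_zero: "AE t in lborel. t \<notin> {0..d} \<longrightarrow> (\<forall>x. resp t x = 0) \<and> slice_energy t = 0"
proof -
  have "AE q in lebesgue_on (UNIV \<times> I). q \<notin> {0..d} \<times> I \<longrightarrow> case_prod \<zeta> q = 0"
    using AE_zero_outside_ess_support by (rule eventually_mono) (use supp in auto)
  then have "AE q in lborel. q \<in> UNIV \<times> I \<longrightarrow> q \<notin> {0..d} \<times> I \<longrightarrow> case_prod \<zeta> q = 0"
    using UNIV_Times_in_sets_lebesgue[OF I_meas]
    by (subst (asm) AE_restrict_space_iff) (auto simp: AE_completion_iff)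
  then have "AE t in lborel. AE \<nu> in lborel. \<nu> \<in> I \<longrightarrow> t \<notin> {0..d} \<longrightarrow> \<zeta> t \<nu> = 0"
    by (intro AE_lborel_pairD) (auto elim!: eventually_mono)
  then show ?thesis
  proof eventually_elim
    case (elim t)
    show ?case
    proof
      assume "t \<notin> {0..d}"
      with elim have *: "AE \<nu> in lebesgue_on I. \<zeta> t \<nu> = 0"
        using I_meas by (subst AE_restrict_space_iff) (auto simp: AE_completion_iff)
      then have "resp t x = 0" for x
        unfolding pointwise_response_def l2_inner_def by (intro integral_eq_zero_AE) (auto elim: eventually_mono)
      moreover have "l2_norm (lebesgue_on I) (\<zeta> t) = 0"
        unfolding l2_norm_def using * by (simp, intro integral_eq_zero_AE) (auto elim: eventually_mono)
      ultimately show "(\<forall>x. resp t x = 0) \<and> slice_energy t = 0"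
        by (simp add: slice_energy_def)
    qed
  qed
qed

text \<open>The line x = t + c is a null set of the plane, so an identity almost everywhere in the
  plane says nothing about it. Here the slices of \<zeta> and of \<open>k\<close> are replaced
  separately, and the exceptional set for \<open>k\<close> is translated by
  \<open>c\<close>.\<close>

lemma resp_diagonal_measurable:
  "\<exists>\<rho>\<in>borel_measurable borel. AE t in lborel. resp t (t + c) = \<rho> t"
proof -
  obtain F where F[measurable]: "case_prod F \<in> borel_measurable (borel \<Otimes>\<^sub>M borel)"
    and F_eq: "AE q in lborel. F (fst q) (snd q) = (if snd q \<in> I then \<zeta> (fst q) (snd q) else 0)"
    using borel_slices[OF l2_measurable[OF symbol_l2] I_meas] .
  obtain G where G[measurable]: "case_prod G \<in> borel_measurable (borel \<Otimes>\<^sub>M borel)"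
    and G_eq: "AE q in lborel. G (fst q) (snd q) = (if snd q \<in> I then k (fst q) (snd q) else 0)"
    using borel_slices[OF k_meas I_meas] .
  have "AE t in lborel. AE \<nu> in lborel. F t \<nu> = (if \<nu> \<in> I then \<zeta> t \<nu> else 0)"
    using F_eq by (rule AE_lborel_pairD)
  moreover have "AE x in lborel. AE \<nu> in lborel. G x \<nu> = (if \<nu> \<in> I then k x \<nu> else 0)"
    using G_eq by (rule AE_lborel_pairD)
  from AE_lborel_translate[OF this]
  have "AE t in lborel. AE \<nu> in lborel. G (t + c) \<nu> = (if \<nu> \<in> I then k (t + c) \<nu> else 0)" .
  ultimately have "AE t in lborel. resp t (t + c) = (LINT \<nu>|lborel. F t \<nu> * cnj (G (t + c) \<nu>))"
  proof eventually_elim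
    case (elim t)
    then show ?case
      unfolding pointwise_response_def by (intro slice_inner[OF I_meas]) auto
  qed
  moreover have "(\<lambda>t. LINT \<nu>|lborel. F t \<nu> * cnj (G (t + c) \<nu>)) \<in> borel_measurable borel"
    by measurable
  ultimately show ?thesis
    by (intro bexI)
qed

section \<open>Disjointness of the translated supports\<close>

lemma resp_zero_off_support:
  "AE x in lborel. \<forall>m. x - y m \<notin> {0<..<d} \<longrightarrow> (\<forall>x'. resp (x - y m) x' = 0)"
proof (subst AE_all_countable, rule allI)
  fix m
  have "AE t in lborel. t \<notin> {0<..<d} \<longrightarrow> (\<forall>x'. resp t x' = 0)"
    \<comment> \<open>The endpoints are discarded as null sets: for d' = d closed intervals of
      length \<open>d\<close> could meet at an endpoint.\<close>
    using slices_zero AE_lborel_singleton[of 0] AE_lborel_singleton[of d]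
    by eventually_elim auto
  from AE_lborel_translate[OF this, of "- y m"]
  show "AE x in lborel. x - y m \<notin> {0<..<d} \<longrightarrow> (\<forall>x'. resp (x - y m) x' = 0)"
    by simp
qed

text \<open>Passing to another index moves x - y by at least \<open>d'\<close>: upwards from at
  least d - d' it lands at or beyond \<open>d\<close>, downwards from at most \<open>d'\<close> it
  lands at or below 0. This is the origin of the window allowed for the support of
  \<open>r\<close>.\<close>

lemma translates_disjoint:
  assumes "x - y m \<in> {d - d'..d'}" "n \<noteq> m"
  shows "x - y n \<notin> {0<..<d}"
proof (cases n m rule: linorder_cases)
  case less
  then show ?thesis
    using gap[OF less] assms(1) by simp
next
  case greater
  then show ?thesis
    using gap[OF greater] assms(1) by simp
qed (use assms(2) in simp)

text \<open>In the window only the term with index \<open>n\<close> can survive at t + y n. The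
  countably many translated null sets are united so that one exceptional set serves all
  \<open>n\<close>.\<close>

lemma train_eq_resp:
  "AE t in lborel. t \<in> {d - d'..d'} \<longrightarrow> (\<forall>n. train (t + y n) = resp t (t + y n))"
proof -
  have "AE t in lborel. \<forall>n m. t + y n - y m \<notin> {0<..<d} \<longrightarrow> (\<forall>x'. resp (t + y n - y m) x' = 0)"
  proof (subst AE_all_countable, rule allI)
    fix n
    show "AE t in lborel. \<forall>m. t + y n - y m \<notin> {0<..<d} \<longrightarrow> (\<forall>x'. resp (t + y n - y m) x' = 0)"
      by (rule AE_lborel_translate[OF resp_zero_off_support])
  qed
  then show ?thesis
  proof eventually_elim
    case (elim t)
    show ?case
    proof (intro impI allI)
      fix n
      assume t: "t \<in> {d - d'..d'}"
      have "resp (t + y n - y m) (t + y n) = 0" if "m \<noteq> n" for m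
        using elim translates_disjoint[of "t + y n" n m] t that by simp
      then have "((\<lambda>m. resp (t + y n - y m) (t + y n)) has_sum resp (t + y n - y n) (t + y n)) UNIV"
        by (rule has_sum_single)
      then show "train (t + y n) = resp t (t + y n)"
        by (simp add: delta_train_response_def infsumI)
    qed
  qed
qed

lemma resp_sparse:
  "AE x in lborel. \<exists>m. \<forall>n. n \<noteq> m \<longrightarrow> resp (x - y n) x = 0"
  using resp_zero_off_support
proof eventually_elim
  case (elim x)
  show ?case
  proof (cases "\<exists>m. x - y m \<in> {0<..<d}")
    case True
    then obtain m where "x - y m \<in> {0<..<d}" ..
    then have "x - y m \<in> {d - d'..d'}"
      using d_le_d' by auto
    then show ?thesis
      using elim translates_disjoint by blast
  next
    \<comment> \<open>Every term is zero here, so any index can serve as \<open>m\<close>.\<close>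
    case False
    then show ?thesis
      using elim by blast
  qed
qed

section \<open>Measurability and energy of the response to the delta train\<close>

lemma train_norm_sq:
  "AE x in lborel. ennreal ((cmod (train x))\<^sup>2)
     = (\<integral>\<^sup>+n. ennreal ((cmod (resp (x - y n) x))\<^sup>2) \<partial>count_space UNIV)"
  using resp_sparse
proof eventually_elim
  case (elim x)
  then obtain m where "\<And>n. n \<noteq> m \<Longrightarrow> resp (x - y n) x = 0"
    by blast
  then show ?case
    unfolding delta_train_response_def by (rule norm_sq_infsum_single)
qed

lemma resp_translates:
  obtains \<rho> where "\<And>n. \<rho> n \<in> borel_measurable borel"
    "AE t in lborel. \<forall>n. resp t (t + y n) = \<rho> n t"
    "AE x in lborel. \<forall>n. resp (x - y n) x = \<rho> n (x - y n)"
proof -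
  have "\<forall>n. \<exists>\<rho>. \<rho> \<in> borel_measurable borel \<and> (AE t in lborel. resp t (t + y n) = \<rho> t)"
    using resp_diagonal_measurable by blast
  then obtain \<rho> where \<rho>: "\<And>n. \<rho> n \<in> borel_measurable borel" "\<And>n. AE t in lborel. resp t (t + y n) = \<rho> n t"
    by (auto dest!: choice)
  show ?thesis
  proof (rule that[of \<rho>])
    show "AE x in lborel. \<forall>n. resp (x - y n) x = \<rho> n (x - y n)"
      unfolding AE_all_countable using AE_lborel_translate[OF \<rho>(2), of "- y n" n for n] by simp
  qed (use \<rho> in \<open>simp_all add: AE_all_countable\<close>)
qed

lemma train_measurable: "train \<in> borel_measurable lebesgue"
proof -
  obtain \<rho> where \<rho>: "\<And>n. \<rho> n \<in> borel_measurable borel"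
    "AE x in lborel. \<forall>n. resp (x - y n) x = \<rho> n (x - y n)"
    using resp_translates by blast
  have [measurable]: "\<rho> n \<in> borel_measurable borel" for n
    by (rule \<rho>)
  \<comment> \<open>Enumerating the integers gives a series of Borel functions, which is Borel.
    Almost everywhere at most one term is nonzero, so the order of summation is immaterial and the
    series equals the response.\<close>
  let ?u = "\<lambda>x. \<Sum>i. \<rho> (from_nat_into UNIV i) (x - y (from_nat_into UNIV i))"
  show ?thesis
  proof (rule completion_measurable_AE_eq)
    show "?u \<in> borel_measurable lborel"
      by measurable
    show "AE x in lborel. train x = ?u x"
      using \<rho>(2) resp_sparse
    proof eventually_elim
      case (elim x)
      then obtain m where m: "\<And>n. n \<noteq> m \<Longrightarrow> resp (x - y n) x = 0"
        by blast
      have "((\<lambda>n. resp (x - y n) x) has_sum resp (x - y m) x) UNIV"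
        by (rule has_sum_single) (rule m)
      moreover from this have "((\<lambda>i. resp (x - y (from_nat_into UNIV i)) x) has_sum resp (x - y m) x) (UNIV :: nat set)"
        by (subst has_sum_reindex_bij_betw[OF bij_betw_from_nat_into]) auto
      from has_sum_imp_sums[OF this] have "(\<Sum>i. resp (x - y (from_nat_into UNIV i)) x) = resp (x - y m) x"
        by (rule sums_unique[symmetric])
      ultimately show ?case
        using elim(1) by (simp add: delta_train_response_def infsumI)
    qed
  qed simp
qed

lemma train_energy:
  "(\<integral>\<^sup>+x. ennreal ((cmod (train x))\<^sup>2) \<partial>lborel)
     = (\<integral>\<^sup>+t. \<integral>\<^sup>+n. ennreal ((cmod (resp t (t + y n)))\<^sup>2) \<partial>count_space UNIV \<partial>lborel)"
proof -
  obtain \<rho> where \<rho>: "\<And>n. \<rho> n \<in> borel_measurable borel"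
    "AE t in lborel. \<forall>n. resp t (t + y n) = \<rho> n t"
    "AE x in lborel. \<forall>n. resp (x - y n) x = \<rho> n (x - y n)"
    using resp_translates by blast
  have [measurable]: "\<rho> n \<in> borel_measurable borel" for n
    by (rule \<rho>)
  have "(\<integral>\<^sup>+x. ennreal ((cmod (train x))\<^sup>2) \<partial>lborel)
      = (\<integral>\<^sup>+x. \<integral>\<^sup>+n. ennreal ((cmod (\<rho> n (x - y n)))\<^sup>2) \<partial>count_space UNIV \<partial>lborel)"
    \<comment> \<open>The Borel versions \<rho> replace the terms before sum and integral are
      interchanged, and are replaced back at the end.\<close>
    using train_norm_sq \<rho>(3) by (intro nn_integral_cong_AE, eventually_elim) simp
  also have "\<dots> = (\<integral>\<^sup>+n. \<integral>\<^sup>+x. ennreal ((cmod (\<rho> n (x - y n)))\<^sup>2) \<partial>lborel \<partial>count_space UNIV)"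
    by (rule nn_integral_count_space_nn_integral) auto
  also have "\<dots> = (\<integral>\<^sup>+n. \<integral>\<^sup>+t. ennreal ((cmod (\<rho> n t))\<^sup>2) \<partial>lborel \<partial>count_space UNIV)"
  proof (rule nn_integral_cong)
    fix n
    show "(\<integral>\<^sup>+x. ennreal ((cmod (\<rho> n (x - y n)))\<^sup>2) \<partial>lborel) = (\<integral>\<^sup>+t. ennreal ((cmod (\<rho> n t))\<^sup>2) \<partial>lborel)"
      by (subst (2) nn_integral_real_affine[of _ 1 "- y n"]) auto
  qed
  also have "\<dots> = (\<integral>\<^sup>+t. \<integral>\<^sup>+n. ennreal ((cmod (\<rho> n t))\<^sup>2) \<partial>count_space UNIV \<partial>lborel)"
    by (rule nn_integral_count_space_nn_integral[symmetric]) auto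
  also have "\<dots> = (\<integral>\<^sup>+t. \<integral>\<^sup>+n. ennreal ((cmod (resp t (t + y n)))\<^sup>2) \<partial>count_space UNIV \<partial>lborel)"
    using \<rho>(2) by (intro nn_integral_cong_AE, eventually_elim) simp
  finally show ?thesis .
qed

text \<open>On \<open>{0..d}\<close> this is the frame inequality for the slice; for almost every
  other \<open>t\<close> all quantities are 0.\<close>

lemma train_energy_slices:
  "AE t in lborel. ennreal A * slice_energy t \<le> (\<integral>\<^sup>+n. ennreal ((cmod (resp t (t + y n)))\<^sup>2) \<partial>count_space UNIV)
     \<and> (\<integral>\<^sup>+n. ennreal ((cmod (resp t (t + y n)))\<^sup>2) \<partial>count_space UNIV) \<le> ennreal B * slice_energy t"
  using slices_l2 slices_zero
proof eventually_elim
  case (elim t)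
  then show ?case
    using frame_sum_bounds[of t "\<zeta> t"]
    by (cases "t \<in> {0..d}") (auto simp: slice_energy_def pointwise_response_def)
qed

lemma train_l2: "train \<in> l2 lebesgue"
  and train_lower: "ennreal A * (\<integral>\<^sup>+t. slice_energy t \<partial>lborel) \<le> ennreal ((l2_norm lebesgue train)\<^sup>2)"
  and train_upper: "ennreal ((l2_norm lebesgue train)\<^sup>2) \<le> ennreal B * (\<integral>\<^sup>+t. slice_energy t \<partial>lborel)"
proof -
  have upper: "(\<integral>\<^sup>+x. ennreal ((cmod (train x))\<^sup>2) \<partial>lborel) \<le> ennreal B * (\<integral>\<^sup>+t. slice_energy t \<partial>lborel)"
    unfolding train_energy slice_energy_cmult[symmetric]
    using train_energy_slices by (intro nn_integral_mono_AE) (auto elim: eventually_mono)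
  also have "\<dots> < \<infinity>"
    using slice_energy_finite by (simp add: ennreal_mult_less_top)
  finally show *: "train \<in> l2 lebesgue"
    using train_measurable by (intro l2I) (simp_all add: nn_integral_completion)
  show "ennreal ((l2_norm lebesgue train)\<^sup>2) \<le> ennreal B * (\<integral>\<^sup>+t. slice_energy t \<partial>lborel)"
    using upper by (simp add: l2_norm_sq_eq_nn_integral[OF *] nn_integral_completion)
  have "ennreal A * (\<integral>\<^sup>+t. slice_energy t \<partial>lborel) \<le> (\<integral>\<^sup>+x. ennreal ((cmod (train x))\<^sup>2) \<partial>lborel)"
    unfolding train_energy slice_energy_cmult[symmetric]
    using train_energy_slices by (intro nn_integral_mono_AE) (auto elim: eventually_mono)
  then show "ennreal A * (\<integral>\<^sup>+t. slice_energy t \<partial>lborel) \<le> ennreal ((l2_norm lebesgue train)\<^sup>2)"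
    by (simp add: l2_norm_sq_eq_nn_integral[OF *] nn_integral_completion)
qed

text \<open>The squared norm of the symbol in L2 of R x I, taken as a real number; finiteness of the
  integral makes the conversion lossless.\<close>

definition energy :: real where
  "energy = enn2real (\<integral>\<^sup>+t. slice_energy t \<partial>lborel)"

lemma energy_nonneg: "0 \<le> energy"
  by (simp add: energy_def)

lemma ennreal_energy: "ennreal energy = (\<integral>\<^sup>+t. slice_energy t \<partial>lborel)"
  using slice_energy_finite by (simp add: energy_def)

lemma train_norm_bounds:
  "A * energy \<le> (l2_norm lebesgue train)\<^sup>2" "(l2_norm lebesgue train)\<^sup>2 \<le> B * energy"
  using train_lower train_upper frame_bound_pos energy_nonneg
  by (simp_all add: ennreal_energy[symmetric] ennreal_mult[symmetric])

section \<open>Comparison of the Hilbert-Schmidt norm with the energy of the symbol\<close>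

lemma hs_norm_sq_eq_slices:
  assumes "H \<in> hs_operators" "has_symbol I k S H \<zeta>"
  shows "ennreal ((hs_norm H)\<^sup>2)
    = (\<integral>\<^sup>+t. ennreal ((l2_norm lebesgue (kernel_map I k (\<zeta> t)))\<^sup>2) \<partial>lborel)"
  unfolding hs_norm_sq_eq_nn_integral_response[OF assms]
proof (rule nn_integral_cong_AE)
  show "AE t in lborel. (\<integral>\<^sup>+x. ennreal ((cmod (resp t x))\<^sup>2) \<partial>lborel)
      = ennreal ((l2_norm lebesgue (kernel_map I k (\<zeta> t)))\<^sup>2)"
    using slices_l2
  proof eventually_elim
    case (elim t)
    then have "kernel_map I k (\<zeta> t) \<in> l2 lebesgue"
      using K_bounded by (auto simp: kernel_map_bounded_def)
    then show ?case
      by (simp add: l2_norm_sq_eq_nn_integral nn_integral_completion kernel_map_def pointwise_response_def)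
  qed
qed

lemma hs_norm_sq_le:
  assumes H: "H \<in> hs_operators" "has_symbol I k S H \<zeta>"
    and M: "\<And>F. F \<in> l2 (lebesgue_on I) \<Longrightarrow> l2_norm lebesgue (kernel_map I k F) \<le> M * l2_norm (lebesgue_on I) F"
  shows "(hs_norm H)\<^sup>2 \<le> M\<^sup>2 * energy"
proof -
  have "ennreal ((hs_norm H)\<^sup>2) \<le> (\<integral>\<^sup>+t. ennreal (M\<^sup>2) * slice_energy t \<partial>lborel)"
    unfolding hs_norm_sq_eq_slices[OF H]
  proof (rule nn_integral_mono_AE)
    show "AE t in lborel. ennreal ((l2_norm lebesgue (kernel_map I k (\<zeta> t)))\<^sup>2) \<le> ennreal (M\<^sup>2) * slice_energy t"
      using slices_l2
    proof eventually_elim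
      case (elim t)
      have "(l2_norm lebesgue (kernel_map I k (\<zeta> t)))\<^sup>2 \<le> (M * l2_norm (lebesgue_on I) (\<zeta> t))\<^sup>2"
        using M[OF elim] by (intro power_mono l2_norm_nonneg)
      then show ?case
        by (simp add: slice_energy_def power_mult_distrib flip: ennreal_mult)
    qed
  qed
  then show ?thesis
    by (simp add: slice_energy_cmult energy_nonneg flip: ennreal_energy ennreal_mult)
qed

lemma hs_norm_sq_ge:
  assumes H: "H \<in> hs_operators" "has_symbol I k S H \<zeta>" and "0 \<le> a"
    and a: "\<And>F. F \<in> l2 (lebesgue_on I) \<Longrightarrow> a * l2_norm (lebesgue_on I) F \<le> l2_norm lebesgue (kernel_map I k F)"
  shows "a\<^sup>2 * energy \<le> (hs_norm H)\<^sup>2"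
proof -
  have "(\<integral>\<^sup>+t. ennreal (a\<^sup>2) * slice_energy t \<partial>lborel) \<le> ennreal ((hs_norm H)\<^sup>2)"
    unfolding hs_norm_sq_eq_slices[OF H]
  proof (rule nn_integral_mono_AE)
    show "AE t in lborel. ennreal (a\<^sup>2) * slice_energy t \<le> ennreal ((l2_norm lebesgue (kernel_map I k (\<zeta> t)))\<^sup>2)"
      using slices_l2
    proof eventually_elim
      case (elim t)
      have "(a * l2_norm (lebesgue_on I) (\<zeta> t))\<^sup>2 \<le> (l2_norm lebesgue (kernel_map I k (\<zeta> t)))\<^sup>2"
        using a[OF elim] \<open>0 \<le> a\<close> by (intro power_mono) (auto simp: l2_norm_nonneg)
      then show ?case
        by (simp add: slice_energy_def power_mult_distrib flip: ennreal_mult)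
    qed
  qed
  then show ?thesis
    by (simp add: slice_energy_cmult energy_nonneg flip: ennreal_energy ennreal_mult)
qed

text \<open>Three regions of \<open>t\<close> are treated: on \<open>{0..d}\<close> the dual frame
  expansion applies and r = 1; in the rest of the window the samples vanish; beyond the window
  \<open>r\<close> vanishes, and convergence of the series is not claimed.\<close>

lemma reconstruction:
  fixes k_dual :: "int \<Rightarrow> real \<Rightarrow> real \<Rightarrow> complex" and r :: "real \<Rightarrow> complex"
  assumes dual: "\<And>t. t \<in> {0..d} \<Longrightarrow> is_dual_frame (lebesgue_on I) (\<lambda>n. k (t + y n)) (\<lambda>n. k_dual n t)"
    and r_one: "\<And>t. t \<in> {0..d} \<Longrightarrow> r t = 1"
    and r_supp: "closure {t. r t \<noteq> 0} \<subseteq> {d - d'..d'}"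
  shows "AE t in lborel. \<forall>x.
    (r t \<noteq> 0 \<longrightarrow> (\<lambda>n. train (t + y n) * l2_inner (lebesgue_on I) (k_dual n t) (k x)) summable_on UNIV) \<and>
    resp t x = r t * (\<Sum>\<^sub>\<infinity>n. train (t + y n) * l2_inner (lebesgue_on I) (k_dual n t) (k x))"
  using slices_l2 slices_zero train_eq_resp
proof eventually_elim
  case (elim t)
  have supp_t: "r t \<noteq> 0 \<Longrightarrow> t \<in> {d - d'..d'}"
    using r_supp closure_subset[of "{t. r t \<noteq> 0}"] by auto
  show ?case
  proof (cases "t \<in> {0..d}")
    case True
    then have "train (t + y n) = l2_inner (lebesgue_on I) (\<zeta> t) (k (t + y n))" for n
      using elim(3) d_le_d' by (simp add: pointwise_response_def)
    then have "((\<lambda>n. train (t + y n) * l2_inner (lebesgue_on I) (k_dual n t) (k x)) has_sum resp t x) UNIV" for x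
      using is_dual_frame_has_sum_inner[OF dual[OF True] elim(1) k_l2] by (simp add: pointwise_response_def)
    then show ?thesis
      using r_one[OF True] by (auto simp: summable_on_def dest: infsumI[symmetric])
  next
    \<comment> \<open>Nothing is known about \<open>k_dual\<close> at such \<open>t\<close>, so the
      argument rests on the samples: where \<open>r\<close> is nonzero they equal the responses,
      which are 0 off \<open>{0..d}\<close>.\<close>
    case False
    then have "train (t + y n) = 0" if "r t \<noteq> 0" for n
      using elim(2,3) supp_t[OF that] by simp
    then show ?thesis
      using False elim(2) by (cases "r t = 0") simp_all
  qed
qed

end

section \<open>Norm bounds with constants independent of operator and symbol\<close>

lemma lower_bound:
  "\<exists>c>0. \<forall>H\<in>op_class I k ({0..d} \<times> I). \<forall>\<zeta>. has_symbol I k ({0..d} \<times> I) H \<zeta> \<longrightarrow>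
     delta_train_response I k \<zeta> y \<in> l2 lebesgue \<and>
     c * hs_norm H \<le> l2_norm lebesgue (delta_train_response I k \<zeta> y)"
proof -
  obtain M0 where M0: "\<And>F. F \<in> l2 (lebesgue_on I) \<Longrightarrow>
      l2_norm lebesgue (kernel_map I k F) \<le> M0 * l2_norm (lebesgue_on I) F"
    using K_bounded by (auto simp: kernel_map_bounded_def)
  \<comment> \<open>The given bound may be zero or negative, for instance when the kernel map is
    zero; the maximum makes division by \<open>M\<close> legitimate.\<close>
  define M where "M = max M0 1"
  have M: "l2_norm lebesgue (kernel_map I k F) \<le> M * l2_norm (lebesgue_on I) F"
    if "F \<in> l2 (lebesgue_on I)" for F
    using M0[OF that] mult_right_mono[of M0 M "l2_norm (lebesgue_on I) F"]
    by (simp add: M_def l2_norm_nonneg)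
  have "0 < M"
    by (simp add: M_def)
  show ?thesis
  \<comment> \<open>Eliminating the energy: the squared norm of \<open>H\<close> is at most M^2
    times the energy, and \<open>A\<close> times the energy is at most the squared norm of the
    response.\<close>
  proof (intro exI[of _ "sqrt A / M"] conjI ballI allI impI)
    show "0 < sqrt A / M"
      using \<open>0 < M\<close> frame_bound_pos by simp
    fix H \<zeta>
    assume "H \<in> op_class I k ({0..d} \<times> I)" and sym: "has_symbol I k ({0..d} \<times> I) H \<zeta>"
    then have H: "H \<in> hs_operators"
      by (simp add: op_class_def)
    have \<zeta>: "case_prod \<zeta> \<in> l2 (lebesgue_on (UNIV \<times> I))"
      "ess_support (lebesgue_on (UNIV \<times> I)) (case_prod \<zeta>) \<subseteq> {0..d} \<times> I"
      using sym by (auto simp: has_symbol_def)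
    show "train \<zeta> \<in> l2 lebesgue"
      by (rule train_l2[OF \<zeta>])
    have "A * (hs_norm H)\<^sup>2 \<le> A * (M\<^sup>2 * energy \<zeta>)"
      using hs_norm_sq_le[OF \<zeta> H sym M] frame_bound_pos by simp
    also have "\<dots> \<le> M\<^sup>2 * (l2_norm lebesgue (train \<zeta>))\<^sup>2"
      using mult_left_mono[OF train_norm_bounds(1)[OF \<zeta>], of "M\<^sup>2"] by (simp add: ac_simps)
    finally have "(sqrt A / M * hs_norm H)\<^sup>2 \<le> (l2_norm lebesgue (train \<zeta>))\<^sup>2"
      using \<open>0 < M\<close> frame_bound_pos by (simp add: power_mult_distrib power_divide field_simps)
    then show "sqrt A / M * hs_norm H \<le> l2_norm lebesgue (train \<zeta>)"
      by (rule power2_le_imp_le) (rule l2_norm_nonneg)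
  qed
qed

lemma upper_bound:
  assumes "kernel_map_bounded_below I k"
  shows "\<exists>C>0. \<forall>H\<in>op_class I k ({0..d} \<times> I). \<forall>\<zeta>. has_symbol I k ({0..d} \<times> I) H \<zeta> \<longrightarrow>
     l2_norm lebesgue (delta_train_response I k \<zeta> y) \<le> C * hs_norm H"
proof -
  obtain a where "0 < a" and a: "\<And>F. F \<in> l2 (lebesgue_on I) \<Longrightarrow>
      a * l2_norm (lebesgue_on I) F \<le> l2_norm lebesgue (kernel_map I k F)"
    using assms by (auto simp: kernel_map_bounded_below_def)
  show ?thesis
  \<comment> \<open>The squared norm of the response is at most \<open>B\<close> times the energy,
    and a^2 times the energy is at most the squared norm of \<open>H\<close>.\<close>
  proof (intro exI[of _ "sqrt B / a"] conjI ballI allI impI)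
    show "0 < sqrt B / a"
      using \<open>0 < a\<close> frame_bound_pos by simp
    fix H \<zeta>
    assume "H \<in> op_class I k ({0..d} \<times> I)" and sym: "has_symbol I k ({0..d} \<times> I) H \<zeta>"
    then have H: "H \<in> hs_operators"
      by (simp add: op_class_def)
    have \<zeta>: "case_prod \<zeta> \<in> l2 (lebesgue_on (UNIV \<times> I))"
      "ess_support (lebesgue_on (UNIV \<times> I)) (case_prod \<zeta>) \<subseteq> {0..d} \<times> I"
      using sym by (auto simp: has_symbol_def)
    have "a\<^sup>2 * (l2_norm lebesgue (train \<zeta>))\<^sup>2 \<le> B * (a\<^sup>2 * energy \<zeta>)"
      using mult_left_mono[OF train_norm_bounds(2)[OF \<zeta>], of "a\<^sup>2"] by (simp add: ac_simps)
    also have "\<dots> \<le> B * (hs_norm H)\<^sup>2"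
      using hs_norm_sq_ge[OF \<zeta> H sym _ a] \<open>0 < a\<close> frame_bound_pos by simp
    finally have "(l2_norm lebesgue (train \<zeta>))\<^sup>2 \<le> (sqrt B / a * hs_norm H)\<^sup>2"
      using \<open>0 < a\<close> frame_bound_pos by (simp add: power_mult_distrib power_divide field_simps)
    then show "l2_norm lebesgue (train \<zeta>) \<le> sqrt B / a * hs_norm H"
      by (rule power2_le_imp_le) (use \<open>0 < a\<close> frame_bound_pos in \<open>simp add: hs_norm_def l2_norm_nonneg\<close>)
  qed
qed

end

theorem theorem4p13:
  fixes d d' A B :: real
    and I :: "real set"
    and k :: "real \<Rightarrow> real \<Rightarrow> complex"
    and y :: "int \<Rightarrow> real"
  assumes d_pos: "0 < d"
    and I_meas: "I \<in> sets lebesgue"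
    and I_bounded: "bounded I"
    and k_meas: "case_prod k \<in> borel_measurable (lebesgue_on (UNIV \<times> I))"
    and k_l2: "\<And>x. k x \<in> l2 (lebesgue_on I)"
    and K_bounded: "kernel_map_bounded I k"
    and frame: "\<And>t. t \<in> {0..d} \<Longrightarrow> frame_bounds (lebesgue_on I) A B (\<lambda>n. k (t + y n))"
    and d'_def: "ereal d' = (INF n. ereal (y (n + 1) - y n))"
    and d_le_d': "d \<le> d'"
  shows
    "(\<exists>c>0. \<forall>H\<in>op_class I k ({0..d} \<times> I). \<forall>\<zeta>. has_symbol I k ({0..d} \<times> I) H \<zeta> \<longrightarrow>
        delta_train_response I k \<zeta> y \<in> l2 lebesgue \<and>
        c * hs_norm H \<le> l2_norm lebesgue (delta_train_response I k \<zeta> y)) \<and>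
     (kernel_map_bounded_below I k \<longrightarrow>
        (\<exists>c>0. \<exists>C>0. \<forall>H\<in>op_class I k ({0..d} \<times> I). \<forall>\<zeta>.
           has_symbol I k ({0..d} \<times> I) H \<zeta> \<longrightarrow>
           delta_train_response I k \<zeta> y \<in> l2 lebesgue \<and>
           c * hs_norm H \<le> l2_norm lebesgue (delta_train_response I k \<zeta> y) \<and>
           l2_norm lebesgue (delta_train_response I k \<zeta> y) \<le> C * hs_norm H) \<and>
        (\<forall>(k_dual :: int \<Rightarrow> real \<Rightarrow> real \<Rightarrow> complex) (\<phi> :: int \<Rightarrow> real \<Rightarrow> real \<Rightarrow> complex)
            (r :: real \<Rightarrow> complex).
           (\<forall>t\<in>{0..d}. is_dual_frame (lebesgue_on I) (\<lambda>n. k (t + y n)) (\<lambda>n. k_dual n t)) \<and>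
           (\<forall>n t x. \<phi> n t x = (LINT \<nu>|lebesgue_on I. k_dual n t \<nu> * cnj (k x \<nu>))) \<and>
           (\<forall>t\<in>{0..d}. r t = 1) \<and> closure {t. r t \<noteq> 0} \<subseteq> {d - d'..d'} \<longrightarrow>
           (\<forall>H\<in>op_class I k ({0..d} \<times> I). \<forall>\<zeta>. has_symbol I k ({0..d} \<times> I) H \<zeta> \<longrightarrow>
              (AE t in lebesgue. \<forall>x.
                 (r t \<noteq> 0 \<longrightarrow>
                    (\<lambda>n. delta_train_response I k \<zeta> y (t + y n) * \<phi> n t x) summable_on UNIV) \<and>
                 pointwise_response I k \<zeta> t x =
                   r t * (\<Sum>\<^sub>\<infinity>n. delta_train_response I k \<zeta> y (t + y n) * \<phi> n t x)))))"
proof -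
  \<comment> \<open>In the extended reals the infimum is a lower bound without a separate
    boundedness argument.\<close>
  have "ereal d' \<le> ereal (y (n + 1) - y n)" for n
    unfolding d'_def by (rule INF_lower) simp
  then have "d' \<le> y (n + 1) - y n" for n
    by simp
  then interpret delta_sampling d d' A B I k y
    using assms by (simp add: delta_sampling_def)
  show ?thesis
  proof (rule conjI[OF lower_bound], intro impI conjI allI ballI)
    assume "kernel_map_bounded_below I k"
    from upper_bound[OF this] lower_bound
    show "\<exists>c>0. \<exists>C>0. \<forall>H\<in>op_class I k ({0..d} \<times> I). \<forall>\<zeta>.
        has_symbol I k ({0..d} \<times> I) H \<zeta> \<longrightarrow>
        train \<zeta> \<in> l2 lebesgue \<and> c * hs_norm H \<le> l2_norm lebesgue (train \<zeta>) \<and>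
        l2_norm lebesgue (train \<zeta>) \<le> C * hs_norm H"
      by blast
  next
    fix k_dual \<phi> :: "int \<Rightarrow> real \<Rightarrow> real \<Rightarrow> complex" and r :: "real \<Rightarrow> complex" and H \<zeta>
    assume *: "(\<forall>t\<in>{0..d}. is_dual_frame (lebesgue_on I) (\<lambda>n. k (t + y n)) (\<lambda>n. k_dual n t)) \<and>
        (\<forall>n t x. \<phi> n t x = (LINT \<nu>|lebesgue_on I. k_dual n t \<nu> * cnj (k x \<nu>))) \<and>
        (\<forall>t\<in>{0..d}. r t = 1) \<and> closure {t. r t \<noteq> 0} \<subseteq> {d - d'..d'}"
      and sym: "has_symbol I k ({0..d} \<times> I) H \<zeta>"
    have \<zeta>: "case_prod \<zeta> \<in> l2 (lebesgue_on (UNIV \<times> I))"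
      "ess_support (lebesgue_on (UNIV \<times> I)) (case_prod \<zeta>) \<subseteq> {0..d} \<times> I"
      using sym by (auto simp: has_symbol_def)
    have "\<phi> n t x = l2_inner (lebesgue_on I) (k_dual n t) (k x)" for n t x
      using * by (simp add: l2_inner_def)
    then show "AE t in lebesgue. \<forall>x.
        (r t \<noteq> 0 \<longrightarrow> (\<lambda>n. train \<zeta> (t + y n) * \<phi> n t x) summable_on UNIV) \<and>
        resp \<zeta> t x = r t * (\<Sum>\<^sub>\<infinity>n. train \<zeta> (t + y n) * \<phi> n t x)"
      using reconstruction[OF \<zeta>, of k_dual r] * by (simp add: AE_completion_iff)
  qed
qed

end
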